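(* Let $A$ be a three-dimensional Sklyanin algebra over $k$ with associated elliptic curve $E\subset\mathbb{P}^2$. The representations in $\mathcal{C}_1$ are (up to isomorphism) exactly the representations of $\Delta$ with spaces $k,k,0$ at the vertices $-2,-1,0$, in which $X_{-2},Y_{-2},Z_{-2}$ act as multiplication by $\alpha,\beta,\gamma$ respectively and $X_{-1},Y_{-1},Z_{-1}$ act as $0$, for some $(\alpha:\beta:\gamma)\in\mathbb{P}^2\setminus E$.
   Context: $k$ is algebraically closed of characteristic zero. $A=k\langle x,y,z\rangle/(ayz+bzy+cx^2,\ azx+bxz+cy^2,\ axy+byx+cz^2)$ with $x,y,z$ in degree one and $(a:b:c)\in\mathbb{P}^2$ satisfying: $abc\ne0$, not $a^3=b^3=c^3$, and $(3abc)^3\neq(a^3+b^3+c^3)^3$. Let $\Gamma\subset\mathbb{P}^2\times\mathbb{P}^2$ be the set of pairs $((x_0:y_0:z_0),(x_1:y_1:z_1))$ with $ay_0z_1+bz_0y_1+cx_0x_1=az_0x_1+bx_0z_1+cy_0y_1=ax_0y_1+by_0x_1+cz_0z_1=0$; it is the graph of a translation $\sigma$ of the smooth elliptic curve $E=\mathrm{pr}_1(\Gamma)\subset\mathbb{P}^2$. $\Delta$ is the quiver with vertices $-2,-1,0$, arrows $X_{-2},Y_{-2},Z_{-2}:-2\to-1$ and $X_{-1},Y_{-1},Z_{-1}:-1\to 0$, and relations (paths composed left to right, i.e. the left arrow is applied first) $aY_{-2}Z_{-1}+bZ_{-2}Y_{-1}+cX_{-2}X_{-1}=0$, $aZ_{-2}X_{-1}+bX_{-2}Z_{-1}+cY_{-2}Y_{-1}=0$,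 $aX_{-2}Y_{-1}+bY_{-2}X_{-1}+cZ_{-2}Z_{-1}=0$. $\mathrm{mod}(\Delta)$ is the category of finite-dimensional representations satisfying these relations; dimension vectors are listed in the order $-2,-1,0$. A point $p\in E$ with $\sigma^ip=(\alpha_i:\beta_i:\gamma_i)$ gives a representation, also denoted $p$, with all three spaces equal to $k$ and $X_i,Y_i,Z_i$ acting by $\alpha_i,\beta_i,\gamma_i$ ($i=-2,-1$). $\mathcal{C}_1$ consists of all $M\in\mathrm{mod}(\Delta)$ with $\underline{\dim}\,M=(1,1,0)$ and $\mathrm{Hom}_\Delta(M,p)=\mathrm{Hom}_\Delta(p,M)=0$ for all $p\in E$. *)

theory Defs
  imports Complex_Main "HOL-Computational_Algebra.Polynomial"
begin

text \<open>
  A point \<open>(x : y : z)\<close> of the projective plane is the set of all its homogeneous coordinate vectors.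
\<close>

definition proj :: "'k::field \<times> 'k \<times> 'k \<Rightarrow> ('k \<times> 'k \<times> 'k) set" where
  "proj = (\<lambda>(x, y, z). {(t * x, t * y, t * z) |t. t \<noteq> 0})"

definition P2 :: "('k::field \<times> 'k \<times> 'k) set set" where
  "P2 = {proj v |v. v \<noteq> (0, 0, 0)}"

definition Gam :: "'k::field \<Rightarrow> 'k \<Rightarrow> 'k \<Rightarrow> (('k \<times> 'k \<times> 'k) set \<times> ('k \<times> 'k \<times> 'k) set) set" where
  "Gam a b c = {(proj (x0, y0, z0), proj (x1, y1, z1)) |x0 y0 z0 x1 y1 z1.
     (x0, y0, z0) \<noteq> (0, 0, 0) \<and> (x1, y1, z1) \<noteq> (0, 0, 0) \<and>
     a * y0 * z1 + b * z0 * y1 + c * x0 * x1 = 0 \<and>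
     a * z0 * x1 + b * x0 * z1 + c * y0 * y1 = 0 \<and>
     a * x0 * y1 + b * y0 * x1 + c * z0 * z1 = 0}"

definition Ecurve :: "'k::field \<Rightarrow> 'k \<Rightarrow> 'k \<Rightarrow> ('k \<times> 'k \<times> 'k) set set" where
  "Ecurve a b c = fst ` Gam a b c"

text \<open>
  Under the Sklyanin conditions on the parameters, \<open>Gam a b c\<close> is the graph of a bijection of
  \<open>Ecurve a b c\<close> onto itself.  The next two definitions are that bijection and its inverse; they are
  meaningful only on \<open>Ecurve a b c\<close>.
\<close>

definition sigma ::
    "'k::field \<Rightarrow> 'k \<Rightarrow> 'k \<Rightarrow> ('k \<times> 'k \<times> 'k) set \<Rightarrow> ('k \<times> 'k \<times> 'k) set" where
  "sigma a b c p = (THE q. (p, q) \<in> Gam a b c)"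

definition sigma_inv ::
    "'k::field \<Rightarrow> 'k \<Rightarrow> 'k \<Rightarrow> ('k \<times> 'k \<times> 'k) set \<Rightarrow> ('k \<times> 'k \<times> 'k) set" where
  "sigma_inv a b c = inv_into (Ecurve a b c) (sigma a b c)"

text \<open>
  Representations of the quiver with vertices \<open>-2, -1, 0\<close>.  The vector spaces at the three vertices
  are the types \<open>'u\<close>, \<open>'v\<close>, \<open>'w\<close> with scalar multiplications \<open>sc2\<close>, \<open>sc1\<close>, \<open>sc0\<close>.  The minus sign of
  the index is dropped in names: \<open>X2\<close> is the action of \<open>X\<^sub>-\<^sub>2\<close>, and so on.
\<close>

record ('k, 'u, 'v, 'w) qrep =
  sc2 :: "'k \<Rightarrow> 'u \<Rightarrow> 'u"
  sc1 :: "'k \<Rightarrow> 'v \<Rightarrow> 'v"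
  sc0 :: "'k \<Rightarrow> 'w \<Rightarrow> 'w"
  X2 :: "'u \<Rightarrow> 'v"
  Y2 :: "'u \<Rightarrow> 'v"
  Z2 :: "'u \<Rightarrow> 'v"
  X1 :: "'v \<Rightarrow> 'w"
  Y1 :: "'v \<Rightarrow> 'w"
  Z1 :: "'v \<Rightarrow> 'w"

definition fin_dim :: "('k::field \<Rightarrow> 'v::ab_group_add \<Rightarrow> 'v) \<Rightarrow> bool" where
  "fin_dim s \<longleftrightarrow> vector_space s \<and> (\<exists>B. finite B \<and> module.span s B = UNIV)"

text \<open>Paths are composed left to right, so \<open>Y\<^sub>-\<^sub>2 Z\<^sub>-\<^sub>1\<close> acts as \<open>\<lambda>u. Z1 M (Y2 M u)\<close>.\<close>

definition mod_Delta :: "'k::field \<Rightarrow> 'k \<Rightarrow> 'k \<Rightarrow>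
    ('k, 'u::ab_group_add, 'v::ab_group_add, 'w::ab_group_add) qrep set" where
  "mod_Delta a b c = {M.
     fin_dim (sc2 M) \<and> fin_dim (sc1 M) \<and> fin_dim (sc0 M) \<and>
     Vector_Spaces.linear (sc2 M) (sc1 M) (X2 M) \<and>
     Vector_Spaces.linear (sc2 M) (sc1 M) (Y2 M) \<and>
     Vector_Spaces.linear (sc2 M) (sc1 M) (Z2 M) \<and>
     Vector_Spaces.linear (sc1 M) (sc0 M) (X1 M) \<and>
     Vector_Spaces.linear (sc1 M) (sc0 M) (Y1 M) \<and>
     Vector_Spaces.linear (sc1 M) (sc0 M) (Z1 M) \<and>
     (\<forall>u. sc0 M a (Z1 M (Y2 M u)) + sc0 M b (Y1 M (Z2 M u)) + sc0 M c (X1 M (X2 M u)) = 0) \<and>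
     (\<forall>u. sc0 M a (X1 M (Z2 M u)) + sc0 M b (Z1 M (X2 M u)) + sc0 M c (Y1 M (Y2 M u)) = 0) \<and>
     (\<forall>u. sc0 M a (Y1 M (X2 M u)) + sc0 M b (X1 M (Y2 M u)) + sc0 M c (Z1 M (Z2 M u)) = 0)}"

definition dim_vec ::
    "('k::field, 'u::ab_group_add, 'v::ab_group_add, 'w::ab_group_add) qrep \<Rightarrow> nat \<times> nat \<times> nat" where
  "dim_vec M = (vector_space.dim (sc2 M) UNIV, vector_space.dim (sc1 M) UNIV,
     vector_space.dim (sc0 M) UNIV)"

definition Hom_Delta ::
    "('k::field, 'u1::ab_group_add, 'v1::ab_group_add, 'w1::ab_group_add) qrep \<Rightarrow>
     ('k, 'u2::ab_group_add, 'v2::ab_group_add, 'w2::ab_group_add) qrep \<Rightarrow>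
     (('u1 \<Rightarrow> 'u2) \<times> ('v1 \<Rightarrow> 'v2) \<times> ('w1 \<Rightarrow> 'w2)) set" where
  "Hom_Delta M N = {(f, g, h).
     Vector_Spaces.linear (sc2 M) (sc2 N) f \<and>
     Vector_Spaces.linear (sc1 M) (sc1 N) g \<and>
     Vector_Spaces.linear (sc0 M) (sc0 N) h \<and>
     g \<circ> X2 M = X2 N \<circ> f \<and> g \<circ> Y2 M = Y2 N \<circ> f \<and> g \<circ> Z2 M = Z2 N \<circ> f \<and>
     h \<circ> X1 M = X1 N \<circ> g \<and> h \<circ> Y1 M = Y1 N \<circ> g \<and> h \<circ> Z1 M = Z1 N \<circ> g}"

definition Hom_zero ::
    "('k::field, 'u1::ab_group_add, 'v1::ab_group_add, 'w1::ab_group_add) qrep \<Rightarrow>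
     ('k, 'u2::ab_group_add, 'v2::ab_group_add, 'w2::ab_group_add) qrep \<Rightarrow> bool" where
  "Hom_zero M N \<longleftrightarrow> Hom_Delta M N = {(\<lambda>_. 0, \<lambda>_. 0, \<lambda>_. 0)}"

definition iso_Delta ::
    "('k::field, 'u1::ab_group_add, 'v1::ab_group_add, 'w1::ab_group_add) qrep \<Rightarrow>
     ('k, 'u2::ab_group_add, 'v2::ab_group_add, 'w2::ab_group_add) qrep \<Rightarrow> bool" where
  "iso_Delta M N \<longleftrightarrow> (\<exists>(f, g, h) \<in> Hom_Delta M N. bij f \<and> bij g \<and> bij h)"

text \<open>
  The representation attached to a point of the curve.  Another choice of homogeneous coordinates
  gives an isomorphic representation.
\<close>

definition coords :: "('k \<times> 'k \<times> 'k) set \<Rightarrow> 'k \<times> 'k \<times> 'k" where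
  "coords p = (SOME v. v \<in> p)"

definition point_rep ::
    "'k::field \<Rightarrow> 'k \<Rightarrow> 'k \<Rightarrow> ('k \<times> 'k \<times> 'k) set \<Rightarrow> ('k, 'k, 'k, 'k) qrep" where
  "point_rep a b c p =
     (let (\<alpha>2, \<beta>2, \<gamma>2) = coords (sigma_inv a b c (sigma_inv a b c p));
          (\<alpha>1, \<beta>1, \<gamma>1) = coords (sigma_inv a b c p)
      in \<lparr>sc2 = (*), sc1 = (*), sc0 = (*),
          X2 = (*) \<alpha>2, Y2 = (*) \<beta>2, Z2 = (*) \<gamma>2,
          X1 = (*) \<alpha>1, Y1 = (*) \<beta>1, Z1 = (*) \<gamma>1\<rparr>)"

definition C1 :: "'k::field \<Rightarrow> 'k \<Rightarrow> 'k \<Rightarrow>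
    ('k, 'u::ab_group_add, 'v::ab_group_add, 'w::ab_group_add) qrep set" where
  "C1 a b c = {M \<in> mod_Delta a b c. dim_vec M = (1, 1, 0) \<and>
     (\<forall>p \<in> Ecurve a b c. Hom_zero M (point_rep a b c p) \<and> Hom_zero (point_rep a b c p) M)}"

text \<open>The one-element type serves as the zero vector space at the vertex \<open>0\<close>.\<close>

instantiation unit :: ab_group_add
begin

definition zero_unit :: unit where "zero_unit = ()"
definition plus_unit :: "unit \<Rightarrow> unit \<Rightarrow> unit" where "plus_unit _ _ = ()"
definition minus_unit :: "unit \<Rightarrow> unit \<Rightarrow> unit" where "minus_unit _ _ = ()"
definition uminus_unit :: "unit \<Rightarrow> unit" where "uminus_unit _ = ()"

instance by standard simp_all

end

definition rep110 :: "'k::field \<Rightarrow> 'k \<Rightarrow> 'k \<Rightarrow> ('k, 'k, 'k, unit) qrep" where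
  "rep110 \<alpha> \<beta> \<gamma> =
     \<lparr>sc2 = (*), sc1 = (*), sc0 = (\<lambda>_ _. 0),
      X2 = (*) \<alpha>, Y2 = (*) \<beta>, Z2 = (*) \<gamma>,
      X1 = (\<lambda>_. 0), Y1 = (\<lambda>_. 0), Z1 = (\<lambda>_. 0)\<rparr>"

end

theory Submission
  imports Defs
begin

text \<open>
  For a fixed first point \<open>(x : y : z)\<close> the equations of \<open>Gam a b c\<close> are linear in the second point, with determinant
  \<open>(a\<^sup>3 + b\<^sup>3 + c\<^sup>3) x y z - a b c (x\<^sup>3 + y\<^sup>3 + z\<^sup>3)\<close>, and their matrix never has rank below two.  As both
  the cubic and \<open>Gam\<close> are unchanged when \<open>a, b\<close> and the two factors are swapped, \<open>\<sigma>\<close> is a bijection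
  of \<open>E\<close>.  A morphism from a representation \<open>M\<close> of dimension vector \<open>(1, 1, 0)\<close> to \<open>p\<close> always
  vanishes, first at the vertex \<open>-1\<close> and then at \<open>-2\<close>, because \<open>p\<close> has nonzero coordinate vectors.
  A nonzero morphism from \<open>p\<close> to \<open>M\<close> exists iff the coordinate vector of \<open>M\<close> is zero or represents
  \<open>\<sigma>\<^sup>-\<^sup>2 p\<close>, and \<open>\<sigma>\<^sup>-\<^sup>2 p\<close> runs through \<open>E\<close> as \<open>p\<close> does.
\<close>

section \<open>Homogeneous coordinates and the incidence relation\<close>

definition incident :: "'k::field \<Rightarrow> 'k \<Rightarrow> 'k \<Rightarrow> 'k \<times> 'k \<times> 'k \<Rightarrow> 'k \<times> 'k \<times> 'k \<Rightarrow> bool" where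
  "incident a b c = (\<lambda>(x0, y0, z0) (x1, y1, z1).
     a * y0 * z1 + b * z0 * y1 + c * x0 * x1 = 0 \<and>
     a * z0 * x1 + b * x0 * z1 + c * y0 * y1 = 0 \<and>
     a * x0 * y1 + b * y0 * x1 + c * z0 * z1 = 0)"

text \<open>This is the determinant of \<open>incident a b c v w\<close> as a linear system in
  \<open>w\<close>; its matrix rows appear as \<open>?R\<close>, \<open>?S\<close>,
  \<open>?T\<close> in \<open>incident_kernel\<close>.\<close>

definition cubic :: "'k::field \<Rightarrow> 'k \<Rightarrow> 'k \<Rightarrow> 'k \<times> 'k \<times> 'k \<Rightarrow> 'k" where
  "cubic a b c = (\<lambda>(x, y, z).
     (a ^ 3 + b ^ 3 + c ^ 3) * (x * y * z) - a * b * c * (x ^ 3 + y ^ 3 + z ^ 3))"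

definition scale3 :: "'k::field \<Rightarrow> 'k \<times> 'k \<times> 'k \<Rightarrow> 'k \<times> 'k \<times> 'k" where
  "scale3 t = (\<lambda>(x, y, z). (t * x, t * y, t * z))"

text \<open>Together with \<open>cubic_swap\<close>, this symmetry carries every statement about one
  factor of \<open>Gam\<close> over to the other factor.\<close>

lemma incident_swap: "incident a b c v w \<longleftrightarrow> incident b a c w v"
  by (auto simp: incident_def algebra_simps split: prod.splits)

lemma cubic_swap: "cubic a b c = cubic b a c"
  by (auto simp: cubic_def algebra_simps)

lemma incident_scale3:
  assumes "s \<noteq> 0" "t \<noteq> 0"
  shows "incident a b c (scale3 s v) (scale3 t w) \<longleftrightarrow> incident a b c v w"
proof -
  obtain x0 y0 z0 x1 y1 z1 where vw: "v = (x0, y0, z0)" "w = (x1, y1, z1)"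
    by (metis prod.exhaust)
  have *: "a * (s * y0) * (t * z1) + b * (s * z0) * (t * y1) + c * (s * x0) * (t * x1)
      = s * t * (a * y0 * z1 + b * z0 * y1 + c * x0 * x1)" for x0 y0 z0 x1 y1 z1
    by (simp add: algebra_simps)
  show ?thesis
    using assms by (simp add: vw incident_def scale3_def *)
qed

lemma proj_eq_scale3: "proj v = {scale3 t v |t. t \<noteq> 0}"
  by (cases v) (auto simp: proj_def scale3_def)

lemma scale3_scale3: "scale3 s (scale3 t v) = scale3 (s * t) v"
  by (cases v) (simp add: scale3_def mult.assoc)

lemma scale3_one [simp]: "scale3 1 v = v"
  by (cases v) (simp add: scale3_def)

lemma scale3_zero [simp]: "scale3 0 v = (0, 0, 0)"
  by (cases v) (simp add: scale3_def)

lemma scale3_eq_zero_iff: "scale3 t v = (0, 0, 0) \<longleftrightarrow> t = 0 \<or> v = (0, 0, 0)"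
  by (cases v) (auto simp: scale3_def)

lemma mem_proj_self: "v \<in> proj v"
  unfolding proj_eq_scale3 by (force intro: exI[of _ 1])

lemma proj_scale3:
  assumes "t \<noteq> 0"
  shows "proj (scale3 t v) = proj v"
proof -
  have "\<exists>r. scale3 s v = scale3 (r * t) v \<and> r \<noteq> 0" if "s \<noteq> 0" for s
    using assms that by (intro exI[of _ "s / t"]) simp
  then show ?thesis
    using assms unfolding proj_eq_scale3 by (force simp: scale3_scale3)
qed

lemma proj_eq_iff: "proj v = proj w \<longleftrightarrow> (\<exists>t. t \<noteq> 0 \<and> v = scale3 t w)"
proof
  assume "proj v = proj w"
  then have "v \<in> proj w" using mem_proj_self[of v] by simp
  then show "\<exists>t. t \<noteq> 0 \<and> v = scale3 t w" unfolding proj_eq_scale3 by blast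
qed (use proj_scale3 in blast)

lemma proj_in_P2_iff: "proj v \<in> P2 \<longleftrightarrow> v \<noteq> (0, 0, 0)"
proof
  assume "proj v \<in> P2"
  then obtain w t where "w \<noteq> (0, 0, 0)" "t \<noteq> 0" "v = scale3 t w"
    unfolding P2_def using proj_eq_iff by blast
  then show "v \<noteq> (0, 0, 0)" by (simp add: scale3_eq_zero_iff)
qed (auto simp only: P2_def)

lemma coords_proj:
  obtains t where "t \<noteq> 0" "coords (proj v) = scale3 t v"
proof -
  have "coords (proj v) \<in> proj v"
    unfolding coords_def by (rule someI[of _ v]) (rule mem_proj_self)
  then show ?thesis using that unfolding proj_eq_scale3 by blast
qed

lemma Gam_eq:
  "Gam a b c = {(proj v, proj w) |v w. v \<noteq> (0, 0, 0) \<and> w \<noteq> (0, 0, 0) \<and> incident a b c v w}"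
  unfolding Gam_def incident_def by fastforce

text \<open>The equations are bihomogeneous, so membership may be tested on any choice of
  representatives.\<close>

lemma Gam_proj_iff:
  "(proj v, proj w) \<in> Gam a b c \<longleftrightarrow> v \<noteq> (0, 0, 0) \<and> w \<noteq> (0, 0, 0) \<and> incident a b c v w"
proof
  assume "(proj v, proj w) \<in> Gam a b c"
  then obtain v' w' where *: "v' \<noteq> (0, 0, 0)" "w' \<noteq> (0, 0, 0)" "incident a b c v' w'"
      and "proj v = proj v'" "proj w = proj w'"
    unfolding Gam_eq by blast
  then obtain s t where "s \<noteq> 0" "v = scale3 s v'" "t \<noteq> 0" "w = scale3 t w'"
    unfolding proj_eq_iff by blast
  with * show "v \<noteq> (0, 0, 0) \<and> w \<noteq> (0, 0, 0) \<and> incident a b c v w"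
    by (simp add: scale3_eq_zero_iff incident_scale3)
qed (auto simp only: Gam_eq)

lemma Gam_swap: "(p, q) \<in> Gam a b c \<longleftrightarrow> (q, p) \<in> Gam b a c"
  unfolding Gam_eq using incident_swap[of a b c] by blast

section \<open>The translation as a bijection of the cubic curve\<close>

text \<open>The vector \<open>(n1, n2, n3)\<close> is the cross product of the rows \<open>r\<close>
  and \<open>s\<close>. If it is nonzero, these rows are independent and their common kernel is the
  line it spans; \<open>det\<close> puts that line into the kernel of \<open>t\<close>.\<close>

lemma kernel_rank_two:
  fixes r1 r2 r3 s1 s2 s3 t1 t2 t3 :: "'k::field"
  defines "n1 \<equiv> r2 * s3 - r3 * s2" and "n2 \<equiv> r3 * s1 - r1 * s3" and "n3 \<equiv> r1 * s2 - r2 * s1"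
  assumes n: "(n1, n2, n3) \<noteq> (0, 0, 0)"
    and det: "t1 * n1 + t2 * n2 + t3 * n3 = 0"
  shows "\<exists>n. n \<noteq> (0, 0, 0) \<and> (\<forall>x y z.
     (r1 * x + r2 * y + r3 * z = 0 \<and> s1 * x + s2 * y + s3 * z = 0 \<and> t1 * x + t2 * y + t3 * z = 0)
     \<longleftrightarrow> (\<exists>k. (x, y, z) = scale3 k n))"
proof (intro exI[of _ "(n1, n2, n3)"] conjI allI iffI n)
  fix x y z
  assume "r1 * x + r2 * y + r3 * z = 0 \<and> s1 * x + s2 * y + s3 * z = 0 \<and> t1 * x + t2 * y + t3 * z = 0"
  then have r: "r1 * x + r2 * y + r3 * z = 0" and s: "s1 * x + s2 * y + s3 * z = 0" by auto
  \<comment> \<open>The cross product of \<open>(n1, n2, n3)\<close> with a vector orthogonal to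
    both \<open>r\<close> and \<open>s\<close> is zero, so the two are parallel. A nonzero
    coordinate of \<open>(n1, n2, n3)\<close> then determines the factor.\<close>
  have cross: "n2 * z = n3 * y" "n3 * x = n1 * z" "n1 * y = n2 * x"
    unfolding n1_def n2_def n3_def using r s by algebra+
  have div: "q = p / m * m'" if "m \<noteq> 0" "m * q = m' * p" for m m' p q :: 'k
    using that by (metis mult.commute nonzero_mult_div_cancel_left times_divide_eq_left)
  consider "n1 \<noteq> 0" | "n2 \<noteq> 0" | "n3 \<noteq> 0" using n by auto
  then show "\<exists>k. (x, y, z) = scale3 k (n1, n2, n3)"
  proof cases
    case 1
    then have "(x, y, z) = scale3 (x / n1) (n1, n2, n3)"
      using div[OF 1 cross(3)] div[OF 1 cross(2)[symmetric]] by (simp add: scale3_def)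
    then show ?thesis ..
  next
    case 2
    then have "(x, y, z) = scale3 (y / n2) (n1, n2, n3)"
      using div[OF 2 cross(1)] div[OF 2 cross(3)[symmetric]] by (simp add: scale3_def)
    then show ?thesis ..
  next
    case 3
    then have "(x, y, z) = scale3 (z / n3) (n1, n2, n3)"
      using div[OF 3 cross(2)] div[OF 3 cross(1)[symmetric]] by (simp add: scale3_def)
    then show ?thesis ..
  qed
next
  fix x y z assume "\<exists>k. (x, y, z) = scale3 k (n1, n2, n3)"
  then obtain k where k: "x = k * n1" "y = k * n2" "z = k * n3" by (auto simp: scale3_def)
  show "r1 * x + r2 * y + r3 * z = 0" "s1 * x + s2 * y + s3 * z = 0"
    unfolding k n1_def n2_def n3_def by algebra+
  show "t1 * x + t2 * y + t3 * z = 0"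
    unfolding k using det by algebra
qed

text \<open>Vanishing of \<open>cubic\<close> bounds the rank of the matrix by two, and the
  conditions on \<open>a\<close>, \<open>b\<close>, \<open>c\<close> exclude smaller rank. The
  solution space is therefore exactly a line.\<close>

lemma incident_kernel:
  fixes a b c :: "'k::field"
  assumes abc: "a * b * c \<noteq> 0" and ne: "\<not> (a ^ 3 = b ^ 3 \<and> b ^ 3 = c ^ 3)"
    and v: "v \<noteq> (0, 0, 0)" and C: "cubic a b c v = 0"
  shows "\<exists>n. n \<noteq> (0, 0, 0) \<and> (\<forall>w. incident a b c v w \<longleftrightarrow> (\<exists>k. w = scale3 k n))"
proof -
  obtain x y z where xyz: "v = (x, y, z)" by (metis prod.exhaust)
  have C': "(a ^ 3 + b ^ 3 + c ^ 3) * (x * y * z) - a * b * c * (x ^ 3 + y ^ 3 + z ^ 3) = 0"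
    using C by (simp add: xyz cubic_def)
  have nz: "a \<noteq> 0" "b \<noteq> 0" "c \<noteq> 0" using abc by auto
  let ?R = "\<lambda>X Y Z. c * x * X + b * z * Y + a * y * Z = 0"
  let ?S = "\<lambda>X Y Z. a * z * X + c * y * Y + b * x * Z = 0"
  let ?T = "\<lambda>X Y Z. b * y * X + a * x * Y + c * z * Z = 0"
  have inc: "incident a b c v (X, Y, Z) \<longleftrightarrow> ?R X Y Z \<and> ?S X Y Z \<and> ?T X Y Z" for X Y Z
    by (simp add: xyz incident_def add_ac)
  \<comment> \<open>These are the cross products of \<open>?R\<close> with \<open>?S\<close> and of
    \<open>?R\<close> with \<open>?T\<close>. The row \<open>?R\<close> is nonzero because
    \<open>a\<close>, \<open>b\<close>, \<open>c\<close> and \<open>v\<close> are, so the vanishing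
    of both would mean rank one.\<close>
  consider
      "(b*z*(b*x) - a*y*(c*y), a*y*(a*z) - c*x*(b*x), c*x*(c*y) - b*z*(a*z)) \<noteq> (0, 0, 0)"
    | "(b*z*(c*z) - a*y*(a*x), a*y*(b*y) - c*x*(c*z), c*x*(a*x) - b*z*(b*y)) \<noteq> (0, 0, 0)"
  proof (rule ccontr)
    \<comment> \<open>If these minors vanish, then \<open>x\<^sup>2 / (y z) = a\<^sup>2 / (b c) = b\<^sup>2 / (a c)\<close> and \<open>y\<^sup>2 / (x z) = b\<^sup>2 / (a c) = c\<^sup>2 / (a b)\<close>.\<close>
    assume "\<not> thesis"
    with that have m: "b*z*(b*x) = a*y*(c*y)" "a*y*(a*z) = c*x*(b*x)" "c*x*(c*y) = b*z*(a*z)"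
        "b*z*(c*z) = a*y*(a*x)" "a*y*(b*y) = c*x*(c*z)" "c*x*(a*x) = b*z*(b*y)"
      by fastforce+
    have x: "x \<noteq> 0"
    proof
      assume "x = 0"
      then show False using m(1,3) nz v by (simp add: xyz)
    qed
    have y: "y \<noteq> 0"
    proof
      assume "y = 0"
      then show False using m(2) nz x by simp
    qed
    have z: "z \<noteq> 0"
    proof
      assume "z = 0"
      then show False using m(2) nz x by simp
    qed
    have "x * y * z * (a^3 - b^3) = 0"
      using m by algebra
    moreover have "x * y * z * (b^3 - c^3) = 0"
      using m by algebra
    ultimately show False using x y z ne by simp
  qed
  then have "\<exists>n. n \<noteq> (0, 0, 0) \<and> (\<forall>X Y Z. ?R X Y Z \<and> ?S X Y Z \<and> ?T X Y Z \<longleftrightarrow> (\<exists>k. (X, Y, Z) = scale3 k n))"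
  proof cases
    case 1
    have "b*y * (b*z*(b*x) - a*y*(c*y)) + a*x * (a*y*(a*z) - c*x*(b*x)) + c*z * (c*x*(c*y) - b*z*(a*z)) = 0"
      using C' by algebra
    then show ?thesis by (rule kernel_rank_two[OF 1])
  next
    case 2
    \<comment> \<open>With the rows in the order \<open>?R\<close>, \<open>?T\<close>,
      \<open>?S\<close> the expansion is minus the determinant; the conjuncts are put back in order
      afterwards.\<close>
    have "a*z * (b*z*(c*z) - a*y*(a*x)) + c*y * (a*y*(b*y) - c*x*(c*z)) + b*x * (c*x*(a*x) - b*z*(b*y)) = 0"
      using C' by algebra
    from kernel_rank_two[OF 2 this] show ?thesis by (simp only: conj_commute conj_left_commute)
  qed
  then show ?thesis by (simp add: inc split_paired_all)
qed

lemma incident_imp_cubic: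
  assumes "incident a b c v w" "w \<noteq> (0, 0, 0)"
  shows "cubic a b c v = 0"
proof -
  obtain x y z X Y Z where vw: "v = (x, y, z)" "w = (X, Y, Z)" by (metis prod.exhaust)
  have e: "a * y * Z + b * z * Y + c * x * X = 0" "a * z * X + b * x * Z + c * y * Y = 0"
     "a * x * Y + b * y * X + c * z * Z = 0"
    using assms by (auto simp: vw incident_def)
  let ?C = "(a ^ 3 + b ^ 3 + c ^ 3) * (x * y * z) - a * b * c * (x ^ 3 + y ^ 3 + z ^ 3)"
  \<comment> \<open>Cramer's rule: multiplying the system by the adjugate matrix gives the
    determinant times each coordinate of \<open>w\<close>.\<close>
  have "X * ?C = 0" "Y * ?C = 0" "Z * ?C = 0" using e by algebra+
  then show ?thesis using assms(2) by (auto simp: vw cubic_def)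
qed

text \<open>A one-dimensional solution space is a single projective point.\<close>

lemma Gam_right_total_unique:
  assumes "a * b * c \<noteq> 0" "\<not> (a ^ 3 = b ^ 3 \<and> b ^ 3 = c ^ 3)"
    and "v \<noteq> (0, 0, 0)" "cubic a b c v = 0"
  shows "\<exists>!q. (proj v, q) \<in> Gam a b c"
proof -
  obtain n where n: "n \<noteq> (0, 0, 0)" "\<And>w. incident a b c v w \<longleftrightarrow> (\<exists>k. w = scale3 k n)"
    using incident_kernel[OF assms] by blast
  show ?thesis
  proof
    show "(proj v, proj n) \<in> Gam a b c"
      using n assms(3) by (auto simp: Gam_proj_iff intro: exI[of _ 1])
    fix q assume q: "(proj v, q) \<in> Gam a b c"
    then obtain w where w: "q = proj w" unfolding Gam_eq by blast
    with q n obtain k where "w = scale3 k n" "w \<noteq> (0, 0, 0)" by (auto simp: Gam_proj_iff)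
    then have "k \<noteq> 0" "w = scale3 k n" by (auto simp: scale3_eq_zero_iff)
    then show "q = proj n" by (simp add: w proj_scale3)
  qed
qed

lemma Ecurve_eq:
  assumes "a * b * c \<noteq> 0" "\<not> (a ^ 3 = b ^ 3 \<and> b ^ 3 = c ^ 3)"
  shows "Ecurve a b c = {proj v |v. v \<noteq> (0, 0, 0) \<and> cubic a b c v = 0}"
proof (intro set_eqI iffI)
  fix p assume "p \<in> Ecurve a b c"
  then show "p \<in> {proj v |v. v \<noteq> (0, 0, 0) \<and> cubic a b c v = 0}"
    unfolding Ecurve_def Gam_eq using incident_imp_cubic by fastforce
next
  fix p assume "p \<in> {proj v |v. v \<noteq> (0, 0, 0) \<and> cubic a b c v = 0}"
  then obtain q where "(p, q) \<in> Gam a b c"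
    using Gam_right_total_unique[OF assms] by blast
  then show "p \<in> Ecurve a b c" unfolding Ecurve_def by force
qed

text \<open>By \<open>Gam_swap\<close>, \<open>Ecurve b a c\<close> is the second projection of
  \<open>Gam a b c\<close>; thus both projections have the same image.\<close>

lemma Ecurve_swap:
  assumes "a * b * c \<noteq> 0" "\<not> (a ^ 3 = b ^ 3 \<and> b ^ 3 = c ^ 3)"
  shows "Ecurve a b c = Ecurve b a c"
proof -
  have "b * a * c \<noteq> 0" "\<not> (b ^ 3 = a ^ 3 \<and> a ^ 3 = c ^ 3)" using assms by auto
  then show ?thesis
    using Ecurve_eq[OF assms] Ecurve_eq[of b a c] cubic_swap[of a b c] by simp
qed

lemma bij_betw_sigma:
  assumes "a * b * c \<noteq> 0" "\<not> (a ^ 3 = b ^ 3 \<and> b ^ 3 = c ^ 3)"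
  shows "bij_betw (sigma a b c) (Ecurve a b c) (Ecurve a b c)"
proof -
  have total: "\<exists>!q. (p, q) \<in> Gam a b c" if "p \<in> Ecurve a b c" for p
    using that Gam_right_total_unique[OF assms] unfolding Ecurve_eq[OF assms] by blast
  have ba: "b * a * c \<noteq> 0" "\<not> (b ^ 3 = a ^ 3 \<and> a ^ 3 = c ^ 3)" using assms by auto
  \<comment> \<open>Functionality of the swapped relation: existence of \<open>p\<close> will give
    surjectivity of \<open>sigma\<close>, uniqueness its injectivity.\<close>
  have surj: "\<exists>!p. (p, q) \<in> Gam a b c" if "q \<in> Ecurve a b c" for q
    using that Gam_right_total_unique[OF ba]
    unfolding Gam_swap[of _ q a b c] Ecurve_swap[OF assms] Ecurve_eq[OF ba] by blast
  have sig: "(p, sigma a b c p) \<in> Gam a b c" if "p \<in> Ecurve a b c" for p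
    unfolding sigma_def using theI'[OF total[OF that]] .
  have mem: "q \<in> Ecurve a b c" if "(p, q) \<in> Gam a b c" for p q
  proof -
    have "(q, p) \<in> Gam b a c" using that Gam_swap by blast
    then have "q \<in> Ecurve b a c" unfolding Ecurve_def by force
    then show ?thesis using Ecurve_swap[OF assms] by simp
  qed
  have dom: "p \<in> Ecurve a b c" if "(p, q) \<in> Gam a b c" for p q
    using that unfolding Ecurve_def by force
  show ?thesis
  proof (rule bij_betw_imageI)
    show "inj_on (sigma a b c) (Ecurve a b c)"
      using sig surj mem by (intro inj_onI) metis
    show "sigma a b c ` Ecurve a b c = Ecurve a b c"
    proof (intro equalityI subsetI)
      fix q assume "q \<in> Ecurve a b c"
      then obtain p where "(p, q) \<in> Gam a b c" using surj by blast
      then have "p \<in> Ecurve a b c" "q = sigma a b c p" using dom sig total by blast+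
      then show "q \<in> sigma a b c ` Ecurve a b c" by blast
    qed (use sig mem in blast)
  qed
qed

lemma bij_betw_sigma_inv:
  assumes "a * b * c \<noteq> 0" "\<not> (a ^ 3 = b ^ 3 \<and> b ^ 3 = c ^ 3)"
  shows "bij_betw (sigma_inv a b c) (Ecurve a b c) (Ecurve a b c)"
  unfolding sigma_inv_def by (rule bij_betw_inv_into[OF bij_betw_sigma[OF assms]])

text \<open>The witness is a common point of all cubics in this family. Some point of the curve is
  required so that a zero coordinate vector is ruled out in \<open>C1_iff_of_chart\<close>.\<close>

lemma Ecurve_nonempty:
  fixes a b c :: "'a::field"
  assumes "a * b * c \<noteq> 0" "\<not> (a ^ 3 = b ^ 3 \<and> b ^ 3 = c ^ 3)"
  shows "Ecurve a b c \<noteq> {}"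
proof -
  have "cubic a b c (1, -1, 0) = 0" by (simp add: cubic_def power3_eq_cube)
  moreover have "(1 :: 'a, -1 :: 'a, 0 :: 'a) \<noteq> (0, 0, 0)" by simp
  ultimately have "proj (1, -1, 0) \<in> Ecurve a b c" unfolding Ecurve_eq[OF assms] by blast
  then show ?thesis by blast
qed

lemma Ecurve_subset_P2: "Ecurve a b c \<subseteq> P2"
  unfolding Ecurve_def Gam_eq P2_def by fastforce

lemma coords_P2:
  assumes "q \<in> P2"
  shows "coords q \<noteq> (0, 0, 0)" and "proj (coords q) = q"
proof -
  obtain v where v: "v \<noteq> (0, 0, 0)" "q = proj v" using assms unfolding P2_def by blast
  obtain t where "t \<noteq> 0" "coords (proj v) = scale3 t v" by (rule coords_proj)
  with v show "coords q \<noteq> (0, 0, 0)" "proj (coords q) = q"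
    by (simp_all add: scale3_eq_zero_iff proj_scale3)
qed

section \<open>Lines and zero spaces over arbitrary carrier types\<close>

lemma vector_space_mult: "vector_space ((*) :: 'k::field \<Rightarrow> 'k \<Rightarrow> 'k)"
  by unfold_locales (simp_all add: algebra_simps)

lemma linear_inv:
  assumes "Vector_Spaces.linear s1 s2 f" "bij f"
  shows "Vector_Spaces.linear s2 s1 (inv f)"
proof -
  have f: "inv f (f x) = x" "f (inv f y) = y" for x y
    using assms(2) by (simp_all add: bij_is_inj bij_is_surj surj_f_inv_f)
  have l: "f (x + y) = f x + f y" "f (s1 r x) = s2 r (f x)" for x y r
    using assms(1) by (auto simp: Vector_Spaces.linear_iff)
  have "inv f (x + y) = inv f x + inv f y" "inv f (s2 r x) = s1 r (inv f x)" for x y r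
    using f l by metis+
  then show ?thesis using assms(1) by (auto simp: Vector_Spaces.linear_iff)
qed

lemma linear_from_field:
  assumes "Vector_Spaces.linear (*) s \<phi>"
  shows "\<phi> t = s t (\<phi> 1)"
  using assms by (metis Vector_Spaces.linear_iff mult.right_neutral)

lemma dim_line:
  assumes "Vector_Spaces.linear (*) s \<phi>" "bij \<phi>"
  shows "vector_space.dim s UNIV = 1"
proof -
  interpret l: Vector_Spaces.linear "(*)" s \<phi> by fact
  have ne: "\<phi> 1 \<noteq> 0"
    using assms(2) l.zero by (metis bij_is_inj injD zero_neq_one)
  have "range (\<lambda>k. s k (\<phi> 1)) = UNIV"
    using linear_from_field[OF assms(1)] bij_is_surj[OF assms(2)] by (metis (mono_tags, lifting) image_cong)
  with ne show ?thesis
    by (intro l.vs2.dim_unique[of "{\<phi> 1}"]) (auto simp: l.vs2.span_singleton)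
qed

lemma line_param:
  assumes "fin_dim s" "vector_space.dim s UNIV = 1"
  shows "\<exists>\<phi>. Vector_Spaces.linear (*) s \<phi> \<and> bij \<phi>"
proof -
  interpret vector_space s using assms(1) by (simp add: fin_dim_def)
  obtain B where B: "independent B" "UNIV \<subseteq> span B" "card B = 1"
    using basis_exists[of UNIV] assms(2) by metis
  then obtain e where e: "B = {e}" using card_1_singletonE by metis
  then have "e \<noteq> 0" using B by auto
  have "Vector_Spaces.linear (*) s (\<lambda>t. s t e)"
    using vector_space_mult vector_space_axioms
    by (auto simp: Vector_Spaces.linear_iff scale_left_distrib)
  moreover have "inj (\<lambda>t. s t e)" using \<open>e \<noteq> 0\<close> by (auto intro: injI)
  moreover have "surj (\<lambda>t. s t e)" using B(2) by (simp add: e span_singleton top.extremum_unique)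
  ultimately show ?thesis unfolding bij_def by blast
qed

lemma dim_trivial:
  fixes s :: "'k::field \<Rightarrow> 'w::ab_group_add \<Rightarrow> 'w"
  assumes "vector_space s" "\<And>w::'w. w = 0"
  shows "vector_space.dim s UNIV = 0"
proof -
  interpret vector_space s by fact
  show ?thesis using assms(2) by (intro dim_unique[of "{}"]) (auto simp: independent_empty)
qed

lemma trivial_of_dim:
  fixes s :: "'k::field \<Rightarrow> 'w::ab_group_add \<Rightarrow> 'w"
  assumes "fin_dim s" "vector_space.dim s UNIV = 0"
  shows "w = (0::'w)"
proof -
  interpret vector_space s using assms(1) by (simp add: fin_dim_def)
  obtain C where C: "finite C" "span C = UNIV" using assms(1) by (auto simp: fin_dim_def)
  obtain B where B: "independent B" "UNIV \<subseteq> span B" "card B = 0"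
    using basis_exists[of UNIV] assms(2) by metis
  \<comment> \<open>\<open>card B = 0\<close> also holds for infinite \<open>B\<close>; the finite
    spanning set \<open>C\<close> excludes that case, so \<open>B\<close> is empty.\<close>
  have "finite B" using independent_span_bound[OF C(1) B(1)] C(2) by simp
  with B show ?thesis by auto
qed

section \<open>Coordinates on representations of dimension vector (1, 1, 0)\<close>

text \<open>A chart reduces computations on arbitrary carriers to scalars in \<open>'k\<close>. The
  last conjunct fixes \<open>X1\<close>, \<open>Y1\<close>, \<open>Z1\<close>, as all maps into a
  zero space agree.\<close>

definition chart ::
    "('k::field, 'u::ab_group_add, 'v::ab_group_add, 'w::ab_group_add) qrep \<Rightarrow>
     ('k \<Rightarrow> 'u) \<Rightarrow> ('k \<Rightarrow> 'v) \<Rightarrow> 'k \<times> 'k \<times> 'k \<Rightarrow> bool" where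
  "chart M \<phi> \<psi> = (\<lambda>(\<alpha>, \<beta>, \<gamma>).
     Vector_Spaces.linear (*) (sc2 M) \<phi> \<and> bij \<phi> \<and>
     Vector_Spaces.linear (*) (sc1 M) \<psi> \<and> bij \<psi> \<and>
     (\<forall>t. X2 M (\<phi> t) = \<psi> (\<alpha> * t) \<and> Y2 M (\<phi> t) = \<psi> (\<beta> * t) \<and> Z2 M (\<phi> t) = \<psi> (\<gamma> * t)) \<and>
     (\<forall>w::'w. w = 0))"

lemma chart_of_dim_vec:
  assumes M: "M \<in> mod_Delta a b c" and d: "dim_vec M = (1, 1, 0)"
  shows "\<exists>\<phi> \<psi> v. chart M \<phi> \<psi> v"
proof -
  have fd: "fin_dim (sc2 M)" "fin_dim (sc1 M)" "fin_dim (sc0 M)"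
    and lin: "Vector_Spaces.linear (sc2 M) (sc1 M) (X2 M)" "Vector_Spaces.linear (sc2 M) (sc1 M) (Y2 M)"
      "Vector_Spaces.linear (sc2 M) (sc1 M) (Z2 M)"
    using M unfolding mod_Delta_def by auto
  obtain \<phi> where \<phi>: "Vector_Spaces.linear (*) (sc2 M) \<phi>" "bij \<phi>"
    using line_param[OF fd(1)] d by (auto simp: dim_vec_def)
  obtain \<psi> where \<psi>: "Vector_Spaces.linear (*) (sc1 M) \<psi>" "bij \<psi>"
    using line_param[OF fd(2)] d by (auto simp: dim_vec_def)
  \<comment> \<open>A linear map between lines is multiplication by the coordinate \<open>r\<close>
    of the image of the basis vector \<open>\<phi> 1\<close>.\<close>
  have act: "\<exists>r. \<forall>t. f (\<phi> t) = \<psi> (r * t)" if f: "Vector_Spaces.linear (sc2 M) (sc1 M) f" for f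
  proof -
    obtain r where r: "f (\<phi> 1) = \<psi> r" using bij_is_surj[OF \<psi>(2)] by (metis surjD)
    have "f (\<phi> t) = \<psi> (r * t)" for t
    proof -
      have "f (\<phi> t) = sc1 M t (\<psi> r)"
        using linear_from_field[OF \<phi>(1), of t] f r by (simp add: Vector_Spaces.linear_iff)
      also have "\<dots> = \<psi> (t * r)" using \<psi>(1) by (simp add: Vector_Spaces.linear_iff)
      finally show ?thesis by (simp add: mult.commute)
    qed
    then show ?thesis by blast
  qed
  have "w = 0" for w :: 'd
    by (rule trivial_of_dim[OF fd(3)]) (use d in \<open>simp add: dim_vec_def\<close>)
  moreover obtain \<alpha> \<beta> \<gamma> where "\<forall>t. X2 M (\<phi> t) = \<psi> (\<alpha> * t)" "\<forall>t. Y2 M (\<phi> t) = \<psi> (\<beta> * t)"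
      "\<forall>t. Z2 M (\<phi> t) = \<psi> (\<gamma> * t)"
    using act[OF lin(1)] act[OF lin(2)] act[OF lin(3)] by blast
  ultimately have "chart M \<phi> \<psi> (\<alpha>, \<beta>, \<gamma>)"
    using \<phi> \<psi> by (simp add: chart_def)
  then show ?thesis by blast
qed

text \<open>A chart is an isomorphism read backwards: \<open>\<phi>\<close> and
  \<open>\<psi>\<close> are the inverses of its components at the vertices -2 and -1.\<close>

lemma iso_rep110_iff_chart:
  assumes M: "M \<in> mod_Delta a b c"
  shows "iso_Delta M (rep110 \<alpha> \<beta> \<gamma>) \<longleftrightarrow> (\<exists>\<phi> \<psi>. chart M \<phi> \<psi> (\<alpha>, \<beta>, \<gamma>))"
proof
  assume "iso_Delta M (rep110 \<alpha> \<beta> \<gamma>)"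
  then obtain f g h where fg: "Vector_Spaces.linear (sc2 M) (*) f" "Vector_Spaces.linear (sc1 M) (*) g"
      "g \<circ> X2 M = (*) \<alpha> \<circ> f" "g \<circ> Y2 M = (*) \<beta> \<circ> f" "g \<circ> Z2 M = (*) \<gamma> \<circ> f"
      and bij: "bij f" "bij g" "bij (h :: 'd \<Rightarrow> unit)"
    unfolding iso_Delta_def Hom_Delta_def rep110_def by auto
  \<comment> \<open>\<open>h\<close> is injective into a one-element type.\<close>
  have "w = 0" for w :: 'd using bij(3) by (auto simp: bij_def inj_def)
  moreover have f: "f (inv f t) = t" for t using bij(1) by (simp add: bij_is_surj surj_f_inv_f)
  moreover have "inv g (g x) = x" for x using bij(2) by (simp add: bij_is_inj)
  then have "X2 M (inv f t) = inv g (\<alpha> * t)" "Y2 M (inv f t) = inv g (\<beta> * t)"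
      "Z2 M (inv f t) = inv g (\<gamma> * t)" for t
    using fg(3-5) f unfolding fun_eq_iff comp_def by metis+
  ultimately have "chart M (inv f) (inv g) (\<alpha>, \<beta>, \<gamma>)"
    unfolding chart_def using linear_inv[OF fg(1) bij(1)] linear_inv[OF fg(2) bij(2)]
      bij_imp_bij_inv[OF bij(1)] bij_imp_bij_inv[OF bij(2)] by simp
  then show "\<exists>\<phi> \<psi>. chart M \<phi> \<psi> (\<alpha>, \<beta>, \<gamma>)" by blast
next
  assume "\<exists>\<phi> \<psi>. chart M \<phi> \<psi> (\<alpha>, \<beta>, \<gamma>)"
  then obtain \<phi> \<psi> where \<phi>: "Vector_Spaces.linear (*) (sc2 M) \<phi>" "bij \<phi>"
      and \<psi>: "Vector_Spaces.linear (*) (sc1 M) \<psi>" "bij \<psi>"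
      and act: "\<And>t. X2 M (\<phi> t) = \<psi> (\<alpha> * t)" "\<And>t. Y2 M (\<phi> t) = \<psi> (\<beta> * t)"
        "\<And>t. Z2 M (\<phi> t) = \<psi> (\<gamma> * t)"
      and w: "\<And>w::'d. w = 0"
    unfolding chart_def by auto
  have inv: "\<phi> (inv \<phi> u) = u" "inv \<psi> (\<psi> t) = t" for u t
    using \<phi>(2) \<psi>(2) by (simp_all add: bij_is_inj bij_is_surj surj_f_inv_f)
  have "inv \<psi> (X2 M u) = \<alpha> * inv \<phi> u" "inv \<psi> (Y2 M u) = \<beta> * inv \<phi> u"
      "inv \<psi> (Z2 M u) = \<gamma> * inv \<phi> u" for u
    using act[of "inv \<phi> u"] inv by simp_all
  moreover have "vector_space (sc0 M)" using M by (simp add: mod_Delta_def fin_dim_def)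
  then have "Vector_Spaces.linear (sc0 M) (\<lambda>_ _. 0) (\<lambda>_. ())"
    by (simp add: Vector_Spaces.linear_iff vector_space_def)
  moreover have "x = y" for x y :: 'd using w[of x] w[of y] by simp
  then have "bij (\<lambda>_::'d. ())" by (intro bijI injI) (auto simp: surj_def)
  ultimately show "iso_Delta M (rep110 \<alpha> \<beta> \<gamma>)"
    unfolding iso_Delta_def Hom_Delta_def rep110_def
    using linear_inv[OF \<phi>] linear_inv[OF \<psi>] bij_imp_bij_inv[OF \<phi>(2)] bij_imp_bij_inv[OF \<psi>(2)]
    by (intro bexI[of _ "(inv \<phi>, inv \<psi>, \<lambda>_. ())"]) (auto simp: fun_eq_iff)
qed

section \<open>Morphisms to and from point representations\<close>

text \<open>Freeing the two coordinate vectors separates the computation of morphisms from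
  \<open>sigma_inv\<close> and from the choice made by \<open>coords\<close>.\<close>

definition line_rep :: "'k::field \<times> 'k \<times> 'k \<Rightarrow> 'k \<times> 'k \<times> 'k \<Rightarrow> ('k, 'k, 'k, 'k) qrep" where
  "line_rep = (\<lambda>(\<alpha>2, \<beta>2, \<gamma>2) (\<alpha>1, \<beta>1, \<gamma>1).
     \<lparr>sc2 = (*), sc1 = (*), sc0 = (*),
      X2 = (*) \<alpha>2, Y2 = (*) \<beta>2, Z2 = (*) \<gamma>2,
      X1 = (*) \<alpha>1, Y1 = (*) \<beta>1, Z1 = (*) \<gamma>1\<rparr>)"

lemma point_rep_eq_line_rep:
  "point_rep a b c p =
     line_rep (coords (sigma_inv a b c (sigma_inv a b c p))) (coords (sigma_inv a b c p))"
  by (simp add: point_rep_def line_rep_def split: prod.splits)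

text \<open>Only linearity is recorded, since \<open>line_rep v w\<close> with arbitrary
  \<open>v\<close> and \<open>w\<close> can violate the quiver relations.\<close>

definition is_rep ::
    "('k::field, 'u::ab_group_add, 'v::ab_group_add, 'w::ab_group_add) qrep \<Rightarrow> bool" where
  "is_rep M \<longleftrightarrow>
     Vector_Spaces.linear (sc2 M) (sc1 M) (X2 M) \<and>
     Vector_Spaces.linear (sc2 M) (sc1 M) (Y2 M) \<and>
     Vector_Spaces.linear (sc2 M) (sc1 M) (Z2 M) \<and>
     Vector_Spaces.linear (sc1 M) (sc0 M) (X1 M) \<and>
     Vector_Spaces.linear (sc1 M) (sc0 M) (Y1 M) \<and>
     Vector_Spaces.linear (sc1 M) (sc0 M) (Z1 M)"

lemma is_rep_mod_Delta: "M \<in> mod_Delta a b c \<Longrightarrow> is_rep M"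
  by (simp add: mod_Delta_def is_rep_def)

lemma linear_mult: "Vector_Spaces.linear (*) (*) ((*) (r :: 'k::field))"
  using vector_space_mult by (simp add: Vector_Spaces.linear_iff algebra_simps)

lemma is_rep_line_rep: "is_rep (line_rep v w)"
  by (simp add: line_rep_def is_rep_def linear_mult split: prod.splits)

lemma linear_zero_vec:
  assumes "Vector_Spaces.linear s1 s2 f"
  shows "f 0 = 0"
proof -
  interpret Vector_Spaces.linear s1 s2 f by fact
  show ?thesis by (rule zero)
qed

lemma linear_zero_map:
  assumes "vector_space s1" "vector_space s2"
  shows "Vector_Spaces.linear s1 s2 (\<lambda>_. 0)"
proof -
  interpret vector_space_pair s1 s2 using assms by (simp add: vector_space_pair_def)
  show ?thesis by (rule linear_zero)
qed

text \<open>The zero triple is always a morphism, because the structure maps of \<open>N\<close>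
  send 0 to 0; only the other inclusion is left to check.\<close>

lemma Hom_zero_iff:
  assumes M: "is_rep M" and N: "is_rep N"
  shows "Hom_zero M N \<longleftrightarrow> (\<forall>f g h. (f, g, h) \<in> Hom_Delta M N \<longrightarrow>
     (\<forall>u. f u = 0) \<and> (\<forall>v. g v = 0) \<and> (\<forall>w. h w = 0))"
proof -
  have vs: "vector_space (sc2 M)" "vector_space (sc1 M)" "vector_space (sc0 M)"
    "vector_space (sc2 N)" "vector_space (sc1 N)" "vector_space (sc0 N)"
    using M N by (auto simp: is_rep_def Vector_Spaces.linear_iff)
  have "X2 N 0 = 0" "Y2 N 0 = 0" "Z2 N 0 = 0" "X1 N 0 = 0" "Y1 N 0 = 0" "Z1 N 0 = 0"
    using N linear_zero_vec unfolding is_rep_def by blast+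
  then have "(\<lambda>_. 0, \<lambda>_. 0, \<lambda>_. 0) \<in> Hom_Delta M N"
    unfolding Hom_Delta_def
    by (simp add: fun_eq_iff linear_zero_map[OF vs(1,4)] linear_zero_map[OF vs(2,5)]
        linear_zero_map[OF vs(3,6)])
  then show ?thesis unfolding Hom_zero_def by (auto simp: fun_eq_iff)
qed

lemma Hom_zero_to_line_rep:
  fixes M :: "('k::field, 'u::ab_group_add, 'v::ab_group_add, 'w::ab_group_add) qrep"
  assumes M: "is_rep M" and w: "\<And>w::'w. w = 0"
    and v2: "v2 \<noteq> (0, 0, 0)" and v1: "v1 \<noteq> (0, 0, 0)"
  shows "Hom_zero M (line_rep v2 v1)"
  unfolding Hom_zero_iff[OF M is_rep_line_rep]
proof (intro allI impI)
  fix f g h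
  assume fgh: "(f, g, h) \<in> Hom_Delta M (line_rep v2 v1)"
  obtain \<alpha>2 \<beta>2 \<gamma>2 \<alpha>1 \<beta>1 \<gamma>1 where v: "v2 = (\<alpha>2, \<beta>2, \<gamma>2)" "v1 = (\<alpha>1, \<beta>1, \<gamma>1)"
    by (metis prod.exhaust)
  have lin: "Vector_Spaces.linear (sc0 M) (*) h"
    and eq2: "g (X2 M u) = \<alpha>2 * f u" "g (Y2 M u) = \<beta>2 * f u" "g (Z2 M u) = \<gamma>2 * f u"
    and eq1: "h (X1 M x) = \<alpha>1 * g x" "h (Y1 M x) = \<beta>1 * g x" "h (Z1 M x) = \<gamma>1 * g x" for u x
    using fgh by (auto simp: Hom_Delta_def line_rep_def v fun_eq_iff)
  have h: "h x = 0" for x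
    using linear_zero_vec[OF lin] w[of x] by simp
  \<comment> \<open>With \<open>h\<close> zero, the squares for the arrows out of -1 say that each
    coordinate of \<open>v1\<close> annihilates \<open>g x\<close>, and one coordinate is
    invertible.\<close>
  then have g: "g x = 0" for x
    using v1 eq1[of x] by (auto simp: v)
  then have "f u = 0" for u
    using v2 eq2[of u] by (auto simp: v)
  with g h show "(\<forall>u. f u = 0) \<and> (\<forall>v. g v = 0) \<and> (\<forall>w. h w = 0)" by blast
qed

text \<open>In the chart a morphism amounts to scalars \<open>r\<close> at -2 and \<open>s\<close>
  at -1 with \<open>scale3 s v2 = scale3 r v\<close>. Only the zero solution exists iff
  \<open>v\<close> and \<open>v2\<close> are linearly independent, which for nonzero
  \<open>v2\<close> is the right-hand side.\<close>

lemma Hom_zero_from_line_rep: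
  fixes M :: "('k::field, 'u::ab_group_add, 'v::ab_group_add, 'w::ab_group_add) qrep"
  assumes M: "is_rep M" and ch: "chart M \<phi> \<psi> v" and v2: "v2 \<noteq> (0, 0, 0)"
  shows "Hom_zero (line_rep v2 v1) M \<longleftrightarrow> v \<noteq> (0, 0, 0) \<and> proj v \<noteq> proj v2"
proof -
  obtain \<alpha>2 \<beta>2 \<gamma>2 \<alpha>1 \<beta>1 \<gamma>1 where v21: "v2 = (\<alpha>2, \<beta>2, \<gamma>2)" "v1 = (\<alpha>1, \<beta>1, \<gamma>1)"
    by (metis prod.exhaust)
  obtain \<alpha> \<beta> \<gamma> where v: "v = (\<alpha>, \<beta>, \<gamma>)" by (metis prod.exhaust)
  have \<phi>: "Vector_Spaces.linear (*) (sc2 M) \<phi>" "bij \<phi>"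
    and \<psi>: "Vector_Spaces.linear (*) (sc1 M) \<psi>" "bij \<psi>"
    and act: "X2 M (\<phi> t) = \<psi> (\<alpha> * t)" "Y2 M (\<phi> t) = \<psi> (\<beta> * t)" "Z2 M (\<phi> t) = \<psi> (\<gamma> * t)"
    and w: "x = (0::'w)" for t x
    using ch unfolding chart_def v by auto
  have vs: "vector_space (sc2 M)" "vector_space (sc1 M)" "vector_space (sc0 M)"
    using M by (auto simp: is_rep_def Vector_Spaces.linear_iff)
  have hom: "(\<phi> \<circ> (*) r, \<psi> \<circ> (*) s, \<lambda>_. 0) \<in> Hom_Delta (line_rep v2 v1) M"
    if "scale3 s v2 = scale3 r v" for r s
  proof -
    have "s * \<alpha>2 = \<alpha> * r" "s * \<beta>2 = \<beta> * r" "s * \<gamma>2 = \<gamma> * r"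
      using that by (auto simp: scale3_def v v21)
    moreover have "X1 M x = 0" "Y1 M x = 0" "Z1 M x = 0" for x by (rule w)+
    ultimately show ?thesis
      using linear_zero_map[OF vector_space_mult vs(3)]
        Vector_Spaces.linear_compose[OF linear_mult \<phi>(1), of r]
        Vector_Spaces.linear_compose[OF linear_mult \<psi>(1), of s]
      by (simp add: Hom_Delta_def line_rep_def v21 fun_eq_iff act flip: mult.assoc)
  qed
  have "\<phi> 1 \<noteq> 0"
    using \<phi> linear_zero_vec[OF \<phi>(1)] by (metis bij_is_inj injD zero_neq_one)
  \<comment> \<open>Here \<open>r = 1\<close>, so the component at -2 sends 1 to
    \<open>\<phi> 1\<close>, which is nonzero. The choice \<open>s = 0\<close> handles
    \<open>v = (0, 0, 0)\<close>, and nonzero \<open>s\<close> handles equal projective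
    points.\<close>
  then have not_zero: "\<not> Hom_zero (line_rep v2 v1) M" if "scale3 s v2 = v" for s
    using hom[of s 1] that unfolding Hom_zero_iff[OF is_rep_line_rep M] by fastforce
  show ?thesis
  proof (intro iffI conjI)
    assume Z: "Hom_zero (line_rep v2 v1) M"
    show "v \<noteq> (0, 0, 0)" using Z not_zero[of 0] by auto
    show "proj v \<noteq> proj v2" using Z not_zero by (auto simp only: proj_eq_iff)
  next
    assume *: "v \<noteq> (0, 0, 0) \<and> proj v \<noteq> proj v2"
    show "Hom_zero (line_rep v2 v1) M"
      unfolding Hom_zero_iff[OF is_rep_line_rep M]
    proof (intro allI impI)
      fix f g h assume fgh: "(f, g, h) \<in> Hom_Delta (line_rep v2 v1) M"
      then have f: "Vector_Spaces.linear (*) (sc2 M) f" and g: "Vector_Spaces.linear (*) (sc1 M) g"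
        and eq: "g (\<alpha>2 * t) = X2 M (f t)" "g (\<beta>2 * t) = Y2 M (f t)" "g (\<gamma>2 * t) = Z2 M (f t)" for t
        by (auto simp: Hom_Delta_def line_rep_def v21 fun_eq_iff)
      obtain r s where r: "f 1 = \<phi> r" and s: "g 1 = \<psi> s"
        using bij_is_surj[OF \<phi>(2)] bij_is_surj[OF \<psi>(2)] by (metis surjD)
      have g': "g t = \<psi> (t * s)" for t
        using linear_from_field[OF g, of t] \<psi>(1) s by (simp add: Vector_Spaces.linear_iff)
      have f': "f t = \<phi> (t * r)" for t
        using linear_from_field[OF f, of t] \<phi>(1) r by (simp add: Vector_Spaces.linear_iff)
      have "\<alpha>2 * s = \<alpha> * r" "\<beta>2 * s = \<beta> * r" "\<gamma>2 * s = \<gamma> * r"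
        using eq[of 1] bij_is_inj[OF \<psi>(2)] by (auto simp: g' r act dest: injD)
      then have sr: "scale3 s v2 = scale3 r v"
        by (simp add: scale3_def v v21 mult.commute)
      \<comment> \<open>A nonzero \<open>r\<close> would force \<open>s\<close> to be nonzero too,
        and \<open>v\<close>, \<open>v2\<close> would represent the same point.\<close>
      have "r = 0"
      proof (rule ccontr)
        assume r: "r \<noteq> 0"
        with sr * have "s \<noteq> 0" by (metis scale3_eq_zero_iff)
        then show False using sr * r by (metis proj_scale3)
      qed
      moreover from this sr v2 have "s = 0" by (metis scale3_eq_zero_iff scale3_zero)
      ultimately show "(\<forall>u. f u = 0) \<and> (\<forall>v. g v = 0) \<and> (\<forall>w. h w = 0)"
        using linear_zero_vec[OF \<phi>(1)] linear_zero_vec[OF \<psi>(1)] w by (simp add: f' g')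
    qed
  qed
qed

section \<open>The classification\<close>

text \<open>The chart already forces the dimension vector, and morphisms to point representations
  vanish. What remains is that \<open>v\<close> is nonzero and represents no point
  \<open>?\<tau> (?\<tau> p)\<close>.\<close>

lemma C1_iff_of_chart:
  fixes M :: "('k::field, 'u::ab_group_add, 'v::ab_group_add, 'w::ab_group_add) qrep"
  assumes abc: "a * b * c \<noteq> 0" "\<not> (a ^ 3 = b ^ 3 \<and> b ^ 3 = c ^ 3)"
    and M: "M \<in> mod_Delta a b c" and ch: "chart M \<phi> \<psi> v"
  shows "M \<in> C1 a b c \<longleftrightarrow> proj v \<in> P2 - Ecurve a b c"
proof -
  have lin: "Vector_Spaces.linear (*) (sc2 M) \<phi>" "bij \<phi>" "Vector_Spaces.linear (*) (sc1 M) \<psi>" "bij \<psi>"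
    and w: "x = (0::'w)" for x
    using ch unfolding chart_def by (auto split: prod.splits)
  have "vector_space (sc0 M)" using M by (simp add: mod_Delta_def fin_dim_def)
  then have dim: "dim_vec M = (1, 1, 0)"
    unfolding dim_vec_def using dim_line[OF lin(1,2)] dim_line[OF lin(3,4)] dim_trivial[OF _ w] by simp
  note rep = is_rep_mod_Delta[OF M]
  let ?E = "Ecurve a b c" and ?\<tau> = "sigma_inv a b c"
  note bij = bij_betw_sigma_inv[OF abc]
  have \<tau>: "?\<tau> p \<in> ?E" if "p \<in> ?E" for p
    using that bij by (auto simp: bij_betw_def)
  have E: "coords p \<noteq> (0, 0, 0)" "proj (coords p) = p" if "p \<in> ?E" for p
    using that Ecurve_subset_P2 coords_P2 by blast+
  have "Hom_zero M (point_rep a b c p) \<and> Hom_zero (point_rep a b c p) M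
      \<longleftrightarrow> v \<noteq> (0, 0, 0) \<and> proj v \<noteq> ?\<tau> (?\<tau> p)" if p: "p \<in> ?E" for p
    unfolding point_rep_eq_line_rep
    using Hom_zero_to_line_rep[OF rep w E(1)[OF \<tau>[OF \<tau>[OF p]]] E(1)[OF \<tau>[OF p]]]
      Hom_zero_from_line_rep[OF rep ch E(1)[OF \<tau>[OF \<tau>[OF p]]]] E(2)[OF \<tau>[OF \<tau>[OF p]]]
    by simp
  then have "M \<in> C1 a b c \<longleftrightarrow> (\<forall>p \<in> ?E. v \<noteq> (0, 0, 0) \<and> proj v \<noteq> ?\<tau> (?\<tau> p))"
    unfolding C1_def using M dim by simp
  \<comment> \<open>Since the curve has a point, the condition \<open>v \<noteq> (0, 0, 0)\<close>
    can leave the scope of the quantifier.\<close>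
  also have "\<dots> \<longleftrightarrow> v \<noteq> (0, 0, 0) \<and> proj v \<notin> (?\<tau> \<circ> ?\<tau>) ` ?E"
    using Ecurve_nonempty[OF abc] by auto
  also have "(?\<tau> \<circ> ?\<tau>) ` ?E = ?E"
    using bij_betw_trans[OF bij bij] by (simp only: bij_betw_def)
  finally show ?thesis by (simp add: proj_in_P2_iff)
qed

lemma fin_dim_mult: "fin_dim ((*) :: 'k::field \<Rightarrow> 'k \<Rightarrow> 'k)"
proof -
  interpret vector_space "(*) :: 'k \<Rightarrow> 'k \<Rightarrow> 'k" by (rule vector_space_mult)
  have "surj (\<lambda>k::'k. k * 1)" by (simp add: surj_def)
  then have "span {1} = UNIV" by (simp only: span_singleton)
  then show ?thesis unfolding fin_dim_def using vector_space_mult by blast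
qed

lemma fin_dim_unit: "fin_dim (\<lambda>(_ :: 'k::field) (_ :: unit). 0)"
proof -
  have "vector_space (\<lambda>(_ :: 'k) (_ :: unit). 0)" by unfold_locales simp_all
  moreover from this have "module.span (\<lambda>(_ :: 'k) (_ :: unit). 0) {} = {0}"
    by (intro module.span_empty) (simp add: module_iff_vector_space)
  moreover have "(UNIV :: unit set) = {0}" by auto
  ultimately show ?thesis unfolding fin_dim_def by (metis finite.emptyI)
qed

text \<open>The relations take values in the zero space at vertex 0, so they hold for all
  coordinates.\<close>

lemma rep110_in_mod_Delta: "rep110 \<alpha> \<beta> \<gamma> \<in> mod_Delta a b c"
proof -
  have "Vector_Spaces.linear ((*) :: 'a \<Rightarrow> _) (\<lambda>_ (_ :: unit). 0) (\<lambda>_. 0)"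
    using fin_dim_unit vector_space_mult unfolding fin_dim_def by (intro linear_zero_map) auto
  then show ?thesis
    unfolding mod_Delta_def rep110_def using fin_dim_unit by (simp add: fin_dim_mult linear_mult)
qed

lemma chart_rep110: "chart (rep110 \<alpha> \<beta> \<gamma>) id id (\<alpha>, \<beta>, \<gamma>)"
  unfolding chart_def rep110_def
  using vector_space_mult by (simp add: Vector_Spaces.linear_iff)

text \<open>The first conjunct concerns the models on the carriers \<open>'k\<close>,
  \<open>'k\<close>, \<open>unit\<close>; the second compares them with representations on arbitrary
  carriers. Both come from \<open>C1_iff_of_chart\<close>, applied to the identity chart and to a
  chart of \<open>M\<close>.\<close>

theorem theorem5p4p1:
  fixes a b c :: "'k::{alg_closed_field, field_char_0}"
  assumes "a * b * c \<noteq> 0"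
    and "\<not> (a ^ 3 = b ^ 3 \<and> b ^ 3 = c ^ 3)"
    and "(3 * a * b * c) ^ 3 \<noteq> (a ^ 3 + b ^ 3 + c ^ 3) ^ 3"
  shows "(\<forall>\<alpha> \<beta> \<gamma>. proj (\<alpha>, \<beta>, \<gamma>) \<in> P2 - Ecurve a b c \<longrightarrow> rep110 \<alpha> \<beta> \<gamma> \<in> C1 a b c)
    \<and> (\<forall>M :: ('k, 'u::ab_group_add, 'v::ab_group_add, 'w::ab_group_add) qrep.
         M \<in> C1 a b c \<longleftrightarrow>
         M \<in> mod_Delta a b c \<and>
         (\<exists>\<alpha> \<beta> \<gamma>. proj (\<alpha>, \<beta>, \<gamma>) \<in> P2 - Ecurve a b c \<and> iso_Delta M (rep110 \<alpha> \<beta> \<gamma>)))"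
proof (intro conjI allI impI)
  fix \<alpha> \<beta> \<gamma> assume "proj (\<alpha>, \<beta>, \<gamma>) \<in> P2 - Ecurve a b c"
  then show "rep110 \<alpha> \<beta> \<gamma> \<in> C1 a b c"
    using C1_iff_of_chart[OF assms(1,2) rep110_in_mod_Delta chart_rep110] by blast
next
  fix M :: "('k, 'u, 'v, 'w) qrep"
  show "M \<in> C1 a b c \<longleftrightarrow>
         M \<in> mod_Delta a b c \<and>
         (\<exists>\<alpha> \<beta> \<gamma>. proj (\<alpha>, \<beta>, \<gamma>) \<in> P2 - Ecurve a b c \<and> iso_Delta M (rep110 \<alpha> \<beta> \<gamma>))"
  proof
    assume C1: "M \<in> C1 a b c"
    then have M: "M \<in> mod_Delta a b c" and "dim_vec M = (1, 1, 0)" by (auto simp: C1_def)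
    then obtain \<phi> \<psi> \<alpha> \<beta> \<gamma> where ch: "chart M \<phi> \<psi> (\<alpha>, \<beta>, \<gamma>)"
      using chart_of_dim_vec by (metis prod.exhaust)
    then have "iso_Delta M (rep110 \<alpha> \<beta> \<gamma>)" using iso_rep110_iff_chart[OF M] by blast
    moreover have "proj (\<alpha>, \<beta>, \<gamma>) \<in> P2 - Ecurve a b c"
      using C1_iff_of_chart[OF assms(1,2) M ch] C1 by blast
    ultimately show "M \<in> mod_Delta a b c \<and>
        (\<exists>\<alpha> \<beta> \<gamma>. proj (\<alpha>, \<beta>, \<gamma>) \<in> P2 - Ecurve a b c \<and> iso_Delta M (rep110 \<alpha> \<beta> \<gamma>))"
      using M by blast
  next
    assume "M \<in> mod_Delta a b c \<and>
        (\<exists>\<alpha> \<beta> \<gamma>. proj (\<alpha>, \<beta>, \<gamma>) \<in> P2 - Ecurve a b c \<and> iso_Delta M (rep110 \<alpha> \<beta> \<gamma>))"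
    then obtain \<alpha> \<beta> \<gamma> where M: "M \<in> mod_Delta a b c"
        and P: "proj (\<alpha>, \<beta>, \<gamma>) \<in> P2 - Ecurve a b c" and "iso_Delta M (rep110 \<alpha> \<beta> \<gamma>)"
      by blast
    then obtain \<phi> \<psi> where "chart M \<phi> \<psi> (\<alpha>, \<beta>, \<gamma>)" using iso_rep110_iff_chart[OF M] by blast
    from C1_iff_of_chart[OF assms(1,2) M this] P show "M \<in> C1 a b c" by blast
  qed
qed

end
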